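(* For all positive integers $n,r$ there is a constant $C(n,r)$ such that the following holds. Suppose that $p$ is prime, $A$ is an $n\times m$ matrix with entries in $\mathbb{Z}/p\mathbb{Z}$ that satisfies the columns condition over $\mathbb{Z}/p\mathbb{Z}$, and $(\mathbb{Z}/p\mathbb{Z})^*=(\mathbb{Z}/p\mathbb{Z})\setminus\{0\}$ is $r$-coloured in such a way that there is no monochromatic solution to $Ax=0$. Then $p\le C(n,r)$ (that is, $p=O_{n,r}(1)$).
   Context: An $n\times m$ matrix $A$ over a field $\mathbb{F}$ satisfies the columns condition over $\mathbb{F}$ if there is a partition $\{P_1,\dots,P_d\}$ of the (index set of the) columns of $A$ such that for every $1\le j\le d$, $\sum_{c\in P_j} c$ lies in the $\mathbb{F}$-span of the columns in $P_1\cup\dots\cup P_{j-1}$ (this span being the zero space when $j=1$). An $r$-colouring of a set is a map from it to $\{1,\dots,r\}$. A monochromatic solution to $Ax=0$ is a vector $x=(x_1,\dots,x_m)$ with $Ax=0$ whose entries $x_1,\dots,x_m$ all lie in $(\mathbb{Z}/p\mathbb{Z})^*$ and all receive the same colour. *)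

theory Defs
  imports "HOL-Number_Theory.Residues" "HOL-Library.Disjoint_Sets" "HOL-Library.FuncSet"
begin

(* The number m of columns varies inside the main statement, so matrices and vectors are
   functions on the index sets {1..n}, {1..m}, with entries in the carrier of a ring F. *)

definition is_matrix :: "('a, 'b) ring_scheme \<Rightarrow> nat \<Rightarrow> nat \<Rightarrow> (nat \<Rightarrow> nat \<Rightarrow> 'a) \<Rightarrow> bool" where
  "is_matrix F n m A \<longleftrightarrow> (\<forall>i\<in>{1..n}. \<forall>j\<in>{1..m}. A i j \<in> carrier F)"

definition col_sum :: "('a, 'b) ring_scheme \<Rightarrow> nat \<Rightarrow> (nat \<Rightarrow> nat \<Rightarrow> 'a) \<Rightarrow> nat set \<Rightarrow> nat \<Rightarrow> 'a" where
  "col_sum F n A S = (\<lambda>i\<in>{1..n}. \<Oplus>\<^bsub>F\<^esub>c\<in>S. A i c)"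

(* For S = {} this is the zero space, as the empty sum is the zero of F. *)
definition col_span :: "('a, 'b) ring_scheme \<Rightarrow> nat \<Rightarrow> (nat \<Rightarrow> nat \<Rightarrow> 'a) \<Rightarrow> nat set \<Rightarrow> (nat \<Rightarrow> 'a) set" where
  "col_span F n A S =
     {(\<lambda>i\<in>{1..n}. \<Oplus>\<^bsub>F\<^esub>c\<in>S. t c \<otimes>\<^bsub>F\<^esub> A i c) | t. t \<in> S \<rightarrow> carrier F}"

definition columns_condition :: "('a, 'b) ring_scheme \<Rightarrow> nat \<Rightarrow> nat \<Rightarrow> (nat \<Rightarrow> nat \<Rightarrow> 'a) \<Rightarrow> bool" where
  "columns_condition F n m A \<longleftrightarrow>
     (\<exists>(d::nat) (P::nat \<Rightarrow> nat set).
        partition_on {1..m} (P ` {1..d}) \<and> inj_on P {1..d} \<and>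
        (\<forall>j\<in>{1..d}. col_sum F n A (P j) \<in> col_span F n A (\<Union>k\<in>{1..<j}. P k)))"

definition monochromatic_solution ::
  "('a, 'b) ring_scheme \<Rightarrow> nat \<Rightarrow> nat \<Rightarrow> (nat \<Rightarrow> nat \<Rightarrow> 'a) \<Rightarrow> ('a \<Rightarrow> nat) \<Rightarrow> (nat \<Rightarrow> 'a) \<Rightarrow> bool" where
  "monochromatic_solution F n m A \<chi> x \<longleftrightarrow>
     x \<in> {1..m} \<rightarrow> carrier F - {\<zero>\<^bsub>F\<^esub>} \<and>
     (\<forall>i\<in>{1..n}. (\<Oplus>\<^bsub>F\<^esub>j\<in>{1..m}. A i j \<otimes>\<^bsub>F\<^esub> x j) = \<zero>\<^bsub>F\<^esub>) \<and>
     (\<exists>k. \<forall>j\<in>{1..m}. \<chi> (x j) = k)"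

end

theory Submission
  imports Defs "HOL-Library.Infinite_Set"
begin

text \<open>
  The columns condition gives a parametrised family of solutions whose shape is bounded in terms
  of \<open>n\<close> alone. Pick a basis \<open>B\<close> of the column space, with at most \<open>n\<close> elements, greedily along
  the blocks, and merge each block into the next one that meets \<open>B\<close>; this leaves at most
  \<open>n + 1\<close> levels. The sum of the columns of a level is a combination of the basis columns of the
  strictly higher levels, so assigning to each column the value \<open>y\<^sub>j\<close> of its level \<open>j\<close>, and correcting
  the columns in \<open>B\<close> by combinations of the \<open>y\<^sub>i\<close> with \<open>i < j\<close>, solves the system. At most
  \<open>(n + 1) n + 1\<close> different coefficients occur.

  It remains to find \<open>y\<close> making all forms \<open>y\<^sub>j + \<Sum>i<j. \<lambda>\<^sub>i y\<^sub>i\<close>, with the \<open>\<lambda>\<^sub>i\<close> in a set of bounded size,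
  nonzero modulo \<open>p\<close> and of one colour. The bounds may depend on the number of coefficients, but
  not on their values. The source of this uniformity is a version of Gallai's theorem, proved by
  colour focusing: for every set \<open>L\<close> of \<open>k\<close> integers there is a homothetic copy \<open>a + b L\<close> of one
  colour with \<open>b\<close>, and the number of possible \<open>a\<close>, bounded in terms of \<open>k\<close> and the number of colours.
  Adding one level at a time, each application having as its shape all values that the
  lower levels can contribute, makes every level monochromatic; by the pigeonhole principle enough
  levels share a colour, and the others are discarded by giving them coefficient \<open>0\<close>.
\<close>

section \<open>Gallai's theorem with uniform bounds\<close>

text \<open>\<open>S\<close> is fixed before the colouring, and only its cardinality is bounded,
  because the elements of \<open>L\<close> may be arbitrarily large.\<close>

definition homothety_set :: "nat \<Rightarrow> nat \<Rightarrow> int set \<Rightarrow> int set \<Rightarrow> bool" where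
  "homothety_set r N L S \<longleftrightarrow> finite S \<and> card S \<le> N \<and>
     (\<forall>c::int \<Rightarrow> nat. (\<forall>x. c x < r) \<longrightarrow>
        (\<exists>a\<in>S. \<exists>b\<in>{1..N}. \<exists>\<kappa>. \<forall>x\<in>L. c (a + int b * x) = \<kappa>))"

text \<open>Meant for product colourings, whose colours are functions: \<open>K\<close> is
  relabelled by an initial segment of the naturals.\<close>

lemma homothety_set_colouring:
  fixes c :: "int \<Rightarrow> 'c"
  assumes hom: "homothety_set r N L S" and c: "\<And>x. c x \<in> K" and K: "finite K" "card K \<le> r"
  shows "\<exists>a\<in>S. \<exists>b\<in>{1..N}. \<exists>\<kappa>. \<forall>x\<in>L. c (a + int b * x) = \<kappa>"
proof -
  obtain h where h: "bij_betw h K {0..<card K}"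
    using ex_bij_betw_finite_nat[OF K(1)] by blast
  have "h (c x) < r" for x
    using bij_betwE[OF h] c[of x] K(2) by fastforce
  then have "\<exists>a\<in>S. \<exists>b\<in>{1..N}. \<exists>\<kappa>. \<forall>x\<in>L. h (c (a + int b * x)) = \<kappa>"
    using hom[unfolded homothety_set_def, THEN conjunct2, THEN conjunct2, THEN spec, of "\<lambda>x. h (c x)"]
    by blast
  then obtain a b \<kappa> where ab: "a \<in> S" "b \<in> {1..N}"
      and eq: "\<And>x. x \<in> L \<Longrightarrow> h (c (a + int b * x)) = \<kappa>"
    by blast
  have "c (a + int b * x) = inv_into K h \<kappa>" if "x \<in> L" for x
  proof -
    have "inv_into K h (h (c (a + int b * x))) = c (a + int b * x)"
      using bij_betw_imp_inj_on[OF h] c by (rule inv_into_f_f)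
    then show ?thesis by (simp only: eq[OF that])
  qed
  then show ?thesis using ab by blast
qed

text \<open>A focus \<open>f\<close> either completes a monochromatic copy of \<open>{0} \<union> L\<close>, or is the common focus of
  copies of \<open>L\<close> in \<open>s\<close> distinct colours. For \<open>s = r\<close> no colour is left for \<open>f\<close>.\<close>

definition focused_set :: "nat \<Rightarrow> nat \<Rightarrow> int set \<Rightarrow> int set \<Rightarrow> nat \<Rightarrow> bool" where
  "focused_set r N L S s \<longleftrightarrow> finite S \<and> card S \<le> N \<and>
     (\<forall>c::int \<Rightarrow> nat. (\<forall>x. c x < r) \<longrightarrow>
        (\<exists>f\<in>S. (\<exists>b\<in>{1..N}. \<forall>x\<in>L. c (f + int b * x) = c f) \<or>
          (\<exists>K. finite K \<and> card K = s \<and> c f \<notin> K \<and>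
             (\<forall>\<kappa>\<in>K. \<exists>b\<in>{1..N}. \<forall>x\<in>L. c (f + int b * x) = \<kappa>))))"

lemma focused_setD:
  assumes "focused_set r N L S s" and "\<forall>x. c x < r"
  shows "\<exists>f\<in>S. (\<exists>b\<in>{1..N}. \<forall>x\<in>L. c (f + int b * x) = c f) \<or>
           (\<exists>K. finite K \<and> card K = s \<and> c f \<notin> K \<and>
             (\<forall>\<kappa>\<in>K. \<exists>b\<in>{1..N}. \<forall>x\<in>L. c (f + int b * x) = \<kappa>))"
  using assms(1)[unfolded focused_set_def, THEN conjunct2, THEN conjunct2, THEN spec, THEN mp, OF assms(2)] .

text \<open>Here \<open>hom\<close> is applied to the patterns of \<open>c\<close> on a window, of
  which there are at most \<open>r ^ (N + N * N * k)\<close>; the pattern then repeats along a copy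
  of \<open>L\<close>. Moving the focus \<open>f\<close> of one pattern to \<open>a + f\<close>
  lengthens the old spokes from ratio \<open>e\<close> to \<open>b + e\<close>, and the copies of
  \<open>f\<close> form a spoke of ratio \<open>b\<close> in a new colour.\<close>

lemma focused_set_Suc:
  assumes foc: "focused_set r N L S s" and hom: "homothety_set (r ^ (N + N * N * k)) N' L S'"
    and L: "finite L" "card L \<le> k"
  shows "focused_set r (N + N' + N' * (N' + 1) * (k + 1) * N) L
           ((\<lambda>(a, b, x, f). a + int b * x + f) ` (S' \<times> {..N'} \<times> insert 0 L \<times> S)) (Suc s)"
    (is "focused_set r ?M L ?T _")
  unfolding focused_set_def
proof (intro conjI allI impI)
  have S: "finite S" "card S \<le> N" "finite S'" "card S' \<le> N'"
    using foc hom by (auto simp: focused_set_def homothety_set_def)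
  show "finite ?T" using S L by auto
  have "card (insert 0 L) \<le> k + 1"
    using L card_insert_le_m1[of "k+1" L 0] by simp
  then have "card S' * ((N' + 1) * (card (insert 0 L) * card S)) \<le> N' * ((N' + 1) * ((k + 1) * N))"
    using S by (intro mult_le_mono) auto
  then have "card (S' \<times> {..N'} \<times> insert 0 L \<times> S) \<le> N' * (N' + 1) * (k + 1) * N"
    by (simp only: card_cartesian_product mult.assoc card_atMost Suc_eq_plus1)
  then show "card ?T \<le> ?M"
    using card_image_le[of "S' \<times> {..N'} \<times> insert 0 L \<times> S" "\<lambda>(a, b, x, f). a + int b * x + f"] S L
    by (simp add: finite_cartesian_product)
  fix c :: "int \<Rightarrow> nat"
  assume c: "\<forall>x. c x < r"
  \<comment> \<open>The window \<open>Q\<close> contains every point that \<open>foc\<close> can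
    speak of: the possible foci and all points of their spokes.\<close>
  define Q where "Q = S \<union> (\<lambda>(f, b, x). f + int b * x) ` (S \<times> {1..N} \<times> L)"
  have finQ: "finite Q" unfolding Q_def using S L by auto
  have "card ((\<lambda>(f, b, x). f + int b * x) ` (S \<times> {1..N} \<times> L)) \<le> card (S \<times> {1..N} \<times> L)"
    using S L by (intro card_image_le) auto
  also have "\<dots> = card S * (N * card L)" by (simp add: card_cartesian_product)
  also have "\<dots> \<le> N * (N * k)" using S L by (intro mult_le_mono) auto
  finally have cardQ: "card Q \<le> N + N * N * k"
    unfolding Q_def using S card_Un_le[of S]
    by (smt (verit) add_mono_thms_linordered_semiring(1) le_trans mult.assoc)
  txt \<open>Colouring \<open>x\<close> by the pattern of \<open>c\<close> on \<open>x + Q\<close> yields translates on which \<open>c\<close> looks the same.\<close>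
  define C where "C x = (\<lambda>u\<in>Q. c (x + u))" for x
  have r: "r \<ge> 1" using c by (cases r) auto
  have "card (Q \<rightarrow>\<^sub>E {..<r}) \<le> r ^ (N + N * N * k)"
    using finQ cardQ r by (simp add: card_PiE power_increasing)
  moreover have "C x \<in> Q \<rightarrow>\<^sub>E {..<r}" for x unfolding C_def using c by auto
  moreover have "finite (Q \<rightarrow>\<^sub>E {..<r})" using finQ by (simp add: finite_PiE)
  ultimately have "\<exists>a\<in>S'. \<exists>b\<in>{1..N'}. \<exists>\<kappa>. \<forall>x\<in>L. C (a + int b * x) = \<kappa>"
    using homothety_set_colouring[OF hom, of C] by blast
  then obtain a b \<kappa> where a: "a \<in> S'" and b: "b \<in> {1..N'}"
    and C: "\<And>x. x \<in> L \<Longrightarrow> C (a + int b * x) = \<kappa>"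
    by blast
  \<comment> \<open>Any element of \<open>L\<close> will do; \<open>0\<close> is the choice for
    empty \<open>L\<close>.\<close>
  obtain x0 where x0: "x0 \<in> insert 0 L" "\<And>x. x \<in> L \<Longrightarrow> C (a + int b * x) = C (a + int b * x0)"
    using C by (cases "L = {}") auto
  have shift: "c (a + int b * x + u) = c (a + int b * x0 + u)" if "x \<in> L" "u \<in> Q" for x u
    using fun_cong[OF x0(2)[OF that(1)], of u] that(2) by (simp add: C_def)
  define c' where "c' u = c (a + int b * x0 + u)" for u
  have c': "\<forall>x. c' x < r" using c by (auto simp: c'_def)
  obtain f where f: "f \<in> S" and alt:
    "(\<exists>b\<in>{1..N}. \<forall>x\<in>L. c' (f + int b * x) = c' f) \<or>
     (\<exists>K. finite K \<and> card K = s \<and> c' f \<notin> K \<and> (\<forall>\<kappa>\<in>K. \<exists>b\<in>{1..N}. \<forall>x\<in>L. c' (f + int b * x) = \<kappa>))"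
    by (rule bexE[OF focused_setD[OF foc c']])
  have fT: "a + int e * x + f \<in> ?T" if "e \<le> N'" "x \<in> insert 0 L" for e x
    using a f that by (intro image_eqI[where x = "(a, e, x, f)"]) auto
  have NM: "N \<le> ?M" "N' \<le> ?M" by auto
  show "\<exists>f\<in>?T. (\<exists>b\<in>{1..?M}. \<forall>x\<in>L. c (f + int b * x) = c f) \<or>
          (\<exists>K. finite K \<and> card K = Suc s \<and> c f \<notin> K \<and>
             (\<forall>\<kappa>\<in>K. \<exists>b\<in>{1..?M}. \<forall>x\<in>L. c (f + int b * x) = \<kappa>))"
    using alt
  proof
    assume "\<exists>b\<in>{1..N}. \<forall>x\<in>L. c' (f + int b * x) = c' f"
    then obtain e where "e \<in> {1..N}" "\<forall>x\<in>L. c (a + int b * x0 + f + int e * x) = c (a + int b * x0 + f)"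
      by (auto simp: c'_def add.assoc)
    then show ?thesis
      using fT[of b x0] b x0(1) NM
      by (intro bexI[where x = "a + int b * x0 + f"] disjI1 bexI[where x = e]) auto
  next
    assume "\<exists>K. finite K \<and> card K = s \<and> c' f \<notin> K \<and>
              (\<forall>\<kappa>\<in>K. \<exists>b\<in>{1..N}. \<forall>x\<in>L. c' (f + int b * x) = \<kappa>)"
    then obtain K where K: "finite K" "card K = s" "c' f \<notin> K"
      and Kb: "\<And>\<kappa>. \<kappa> \<in> K \<Longrightarrow> \<exists>b\<in>{1..N}. \<forall>x\<in>L. c' (f + int b * x) = \<kappa>" by blast
    define K' where "K' = insert (c' f) K"
    have K': "\<exists>b\<in>{1..?M}. \<forall>x\<in>L. c (a + f + int b * x) = \<kappa>" if "\<kappa> \<in> K'" for \<kappa>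
    proof (cases "\<kappa> = c' f")
      case True
      have "c (a + f + int b * x) = \<kappa>" if "x \<in> L" for x
        using shift[OF that, of f] f by (simp add: True c'_def Q_def algebra_simps)
      then show ?thesis using b NM by (intro bexI[where x = b]) auto
    next
      case False
      then obtain e where e: "e \<in> {1..N}" "\<And>x. x \<in> L \<Longrightarrow> c' (f + int e * x) = \<kappa>"
        using Kb \<open>\<kappa> \<in> K'\<close> unfolding K'_def by blast
      have "c (a + f + int (b + e) * x) = \<kappa>" if "x \<in> L" for x
      proof -
        have "f + int e * x \<in> Q" unfolding Q_def using f e that by force
        from shift[OF that this] show ?thesis
          using e(2)[OF that] by (simp add: c'_def algebra_simps)
      qed
      moreover have "b + e \<le> ?M" using b e NM by auto
      ultimately show ?thesis using b by (intro bexI[where x = "b + e"]) auto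
    qed
    have "a + f \<in> ?T" using fT[of 0 0] by simp
    \<comment> \<open>A spoke in the colour of \<open>a + f\<close> completes a monochromatic copy;
      otherwise \<open>K'\<close> supplies \<open>Suc s\<close> colours.\<close>
    show ?thesis
    proof (cases "c (a + f) \<in> K'")
      case True
      with K' \<open>a + f \<in> ?T\<close> show ?thesis by blast
    next
      case False
      moreover have "finite K'" "card K' = Suc s" using K by (auto simp: K'_def)
      ultimately show ?thesis using K' \<open>a + f \<in> ?T\<close> by blast
    qed
  qed
qed
text \<open>The outer induction keeps \<open>r\<close> arbitrary, since adding a spoke calls the
  statement for \<open>k\<close> with the number of patterns as the number of colours. Uniformity is
  the choice of \<open>N\<close> before \<open>L\<close>.\<close>

lemma homothety_set_exists:
  "\<exists>N. \<forall>L. finite L \<and> card L \<le> k \<longrightarrow> (\<exists>S. homothety_set r N L S)"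
proof (induction k arbitrary: r)
  case 0
  have "homothety_set r 1 {} {0}" by (auto simp: homothety_set_def)
  then show ?case by (intro exI[of _ 1]) auto
next
  case (Suc k)
  have "\<exists>N. \<forall>L. finite L \<and> card L \<le> k \<longrightarrow> (\<exists>S. focused_set r N L S s)" for s
  proof (induction s)
    case 0
    have "focused_set r 1 L {0} 0" for L
      unfolding focused_set_def by (auto intro!: exI[of _ "{}::nat set"])
    then show ?case by blast
  next
    case (Suc s)
    then obtain N where N: "\<And>L. finite L \<Longrightarrow> card L \<le> k \<Longrightarrow> \<exists>S. focused_set r N L S s" by blast
    obtain N' where N': "\<And>L. finite L \<Longrightarrow> card L \<le> k \<Longrightarrow>
        \<exists>S. homothety_set (r ^ (N + N * N * k)) N' L S"
      using \<open>\<And>r. \<exists>N. \<forall>L. finite L \<and> card L \<le> k \<longrightarrow> (\<exists>S. homothety_set r N L S)\<close> by blast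
    have "\<exists>S. focused_set r (N + N' + N' * (N' + 1) * (k + 1) * N) L S (Suc s)"
      if L: "finite L" "card L \<le> k" for L
    proof -
      obtain S S' where "focused_set r N L S s" "homothety_set (r ^ (N + N * N * k)) N' L S'"
        using N N' L by blast
      from focused_set_Suc[OF this L] show ?thesis by blast
    qed
    then show ?case by blast
  qed
  from this[of r] obtain N where
    N: "\<And>L. finite L \<Longrightarrow> card L \<le> k \<Longrightarrow> \<exists>S. focused_set r N L S r" by blast
  have "\<exists>S. homothety_set r (N + 1 + N * N) L S" if L: "finite L" "card L \<le> Suc k" for L
  proof (cases "L = {}")
    case True
    have "homothety_set r (N + 1 + N * N) {} {0}" by (auto simp: homothety_set_def)
    with True show ?thesis by blast
  next
    case False
    then obtain \<mu> where \<mu>: "\<mu> \<in> L" by blast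
    \<comment> \<open>Translating \<open>\<mu>\<close> to \<open>0\<close> leaves at most
      \<open>k\<close> other points. A copy of \<open>insert 0 D\<close> at \<open>f\<close> with
      ratio \<open>b\<close> is a copy of \<open>L\<close> based at
      \<open>f - int b * \<mu>\<close>.\<close>
    define D where "D = (\<lambda>x. x - \<mu>) ` (L - {\<mu>})"
    have "finite D" "card D \<le> k"
      using L \<mu> card_image_le[of "L - {\<mu>}" "\<lambda>x. x - \<mu>"] by (auto simp: D_def)
    then obtain S where S: "focused_set r N D S r" using N by blast
    then have finS: "finite S" "card S \<le> N" by (auto simp: focused_set_def)
    define T where "T = (\<lambda>(f, b). f - int b * \<mu>) ` (S \<times> {1..N})"
    have "card T \<le> card (S \<times> {1..N})" unfolding T_def using finS by (intro card_image_le) auto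
    also have "\<dots> \<le> N * N" using finS by (simp add: card_cartesian_product)
    finally have cardT: "card T \<le> N * N" .
    have "\<exists>a\<in>T. \<exists>b\<in>{1..N}. \<exists>\<kappa>. \<forall>x\<in>L. c (a + int b * x) = \<kappa>"
      if c: "\<forall>x. c x < r" for c :: "int \<Rightarrow> nat"
    proof -
      obtain f where f: "f \<in> S" and alt:
        "(\<exists>b\<in>{1..N}. \<forall>x\<in>D. c (f + int b * x) = c f) \<or>
         (\<exists>K. finite K \<and> card K = r \<and> c f \<notin> K \<and> (\<forall>\<kappa>\<in>K. \<exists>b\<in>{1..N}. \<forall>x\<in>D. c (f + int b * x) = \<kappa>))"
        by (rule bexE[OF focused_setD[OF S c]])
      \<comment> \<open>The \<open>r\<close> spoke colours and the different colour of
        \<open>f\<close> would be too many. Only nonempty spokes force \<open>K\<close> to consist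
        of colours below \<open>r\<close>, so empty \<open>D\<close> is treated apart.\<close>
      have "\<exists>b\<in>{1..N}. \<forall>x\<in>D. c (f + int b * x) = c f"
      proof (cases "D = {}")
        case True
        have "N \<ge> 1" using f finS by (cases N) auto
        then show ?thesis using True by auto
      next
        case False
        have False if "finite K" "card K = r" "c f \<notin> K" "\<forall>\<kappa>\<in>K. \<exists>b\<in>{1..N}. \<forall>x\<in>D. c (f + int b * x) = \<kappa>" for K
        proof -
          obtain d where "d \<in> D" using False by blast
          with that(4) c have "insert (c f) K \<subseteq> {..<r}" by fastforce
          then have "card (insert (c f) K) \<le> r" using card_mono[of "{..<r}"] by fastforce
          with that show False by simp
        qed
        with alt show ?thesis by blast
      qed
      then obtain b where b: "b \<in> {1..N}" "\<And>x. x \<in> D \<Longrightarrow> c (f + int b * x) = c f" by blast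
      have "c (f - int b * \<mu> + int b * x) = c f" if "x \<in> L" for x
      proof (cases "x = \<mu>")
        case False
        then have "x - \<mu> \<in> D" using that by (auto simp: D_def)
        from b(2)[OF this] show ?thesis by (simp add: algebra_simps)
      qed simp
      moreover have "f - int b * \<mu> \<in> T" unfolding T_def using f b by force
      ultimately show ?thesis using b(1) by blast
    qed
    then have "homothety_set r (N + 1 + N * N) L T"
      using cardT finS unfolding homothety_set_def T_def by fastforce
    then show ?thesis by blast
  qed
  then show ?case by blast
qed

section \<open>Monochromatic systems of linear forms\<close>

text \<open>\<open>U\<close> also precedes the colouring: the combinations of the lower levels then
  form a set of bounded size known in advance, the shape for the next use of Gallai's theorem. Each
  level may have its own colour.\<close>

definition layered_set :: "nat \<Rightarrow> nat \<Rightarrow> nat \<Rightarrow> nat \<Rightarrow> int set \<Rightarrow> int set \<Rightarrow> bool" where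
  "layered_set p r M N L U \<longleftrightarrow> finite U \<and> card U \<le> N \<and>
     (\<forall>c::int \<Rightarrow> nat. (\<forall>x. c x < r) \<longrightarrow>
        (\<exists>y\<in>{..<M} \<rightarrow> U. \<exists>\<kappa>::nat \<Rightarrow> nat. \<forall>j<M. \<forall>l\<in>{..<j} \<rightarrow> L.
           \<not> int p dvd y j + (\<Sum>i<j. l i * y i) \<and> c (y j + (\<Sum>i<j. l i * y i)) = \<kappa> j))"

lemma layered_setD:
  assumes "layered_set p r M N L U" and "\<forall>x. c x < r"
  shows "\<exists>y\<in>{..<M} \<rightarrow> U. \<exists>\<kappa>. \<forall>j<M. \<forall>l\<in>{..<j} \<rightarrow> L.
           \<not> int p dvd y j + (\<Sum>i<j. l i * y i) \<and> c (y j + (\<Sum>i<j. l i * y i)) = \<kappa> j"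
  using assms(1)[unfolded layered_set_def, THEN conjunct2, THEN conjunct2, THEN spec, THEN mp, OF assms(2)] .

lemma homothety_setD:
  assumes "homothety_set r N L S" and "\<And>x. c x < r"
  obtains a b \<kappa> where "a \<in> S" "b \<in> {1..N}" "\<And>x. x \<in> L \<Longrightarrow> c (a + int b * x) = \<kappa>"
  using homothety_set_colouring[OF assms(1), of c "{..<r}"] assms(2) by auto

text \<open>Each \<open>w\<close> forbids one residue class for \<open>z\<close>, so fewer than
  \<open>p\<close> classes are forbidden.\<close>

lemma exists_shift_avoiding_multiples:
  fixes W :: "int set"
  assumes "finite W" and "card W < p"
  obtains z where "\<And>w. w \<in> W \<Longrightarrow> \<not> int p dvd w + z"
proof -
  have "card ((\<lambda>w. (- w) mod int p) ` W) < card {0..<int p}"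
    using card_image_le[OF assms(1), of "\<lambda>w. (- w) mod int p"] assms(2) by simp
  then have "\<not> {0..<int p} \<subseteq> (\<lambda>w. (- w) mod int p) ` W"
    using card_mono[of "(\<lambda>w. (- w) mod int p) ` W" "{0..<int p}"] assms(1) by auto
  then obtain z where z: "z \<in> {0..<int p}" "z \<notin> (\<lambda>w. (- w) mod int p) ` W" by blast
  have "\<not> int p dvd w + z" if "w \<in> W" for w
  proof
    assume "int p dvd w + z"
    then have "(- w) mod int p = z mod int p"
      by (simp add: mod_eq_dvd_iff dvd_minus_iff[of _ "- w - z", symmetric] add.commute)
    then show False using z that by auto
  qed
  then show thesis using that by blast
qed

lemma card_linear_combinations:
  fixes L U :: "int set" and M :: nat
  assumes "finite L" "card L \<le> k" "finite U" "card U \<le> N"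
  defines "T \<equiv> (\<lambda>g. \<Sum>i<M. fst (g i) * snd (g i)) ` ({..<M} \<rightarrow>\<^sub>E L \<times> U)"
  shows "finite T" and "card T \<le> (k * N) ^ M"
proof -
  show "finite T" unfolding T_def using assms by (auto intro!: finite_PiE)
  have "card T \<le> card ({..<M} \<rightarrow>\<^sub>E L \<times> U)"
    unfolding T_def using assms by (intro card_image_le finite_PiE) auto
  also have "\<dots> = (card L * card U) ^ M" by (simp add: card_PiE card_cartesian_product)
  also have "\<dots> \<le> (k * N) ^ M" using assms by (intro power_mono mult_le_mono) auto
  finally show "card T \<le> (k * N) ^ M" .
qed

text \<open>The new top level is the base point \<open>a + z\<close> of a copy of \<open>T\<close>, and the old levels are dilated by
  its ratio \<open>b\<close>; the shift \<open>z\<close> keeps the new forms away from \<open>0\<close>.\<close>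

lemma layered_set_Suc:
  assumes lay: "layered_set p r M N L U" and L: "finite L" "card L \<le> k" and p: "prime p"
    and T: "T = (\<lambda>g. \<Sum>i<M. fst (g i) * snd (g i)) ` ({..<M} \<rightarrow>\<^sub>E L \<times> U)"
    and hom: "homothety_set r N' T S"
    and large: "N' + N' * (N' * (k * N) ^ M) < p"
  shows "\<exists>U'. layered_set p r (Suc M) (N' + N' * N) L U'"
proof -
  have U: "finite U" "card U \<le> N" and S: "finite S" "card S \<le> N'"
    using lay hom by (auto simp: layered_set_def homothety_set_def)
  have finT: "finite T" and cardT: "card T \<le> (k * N) ^ M"
    unfolding T using card_linear_combinations[OF L U] by auto
  have TI: "(\<Sum>i<M. l i * y i) \<in> T" if "l \<in> {..<M} \<rightarrow> L" "y \<in> {..<M} \<rightarrow> U" for l y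
    unfolding T using that
    by (intro image_eqI[where x = "\<lambda>i\<in>{..<M}. (l i, y i)"]) auto
  \<comment> \<open>All values that the new level can take before the shift, over every possible
    outcome of \<open>hom\<close>; thus \<open>z\<close>, and with it \<open>U'\<close>, does not
    depend on the colouring.\<close>
  define W where "W = (\<lambda>(a, b, v). a + int b * v) ` (S \<times> {1..N'} \<times> T)"
  have finW: "finite W" unfolding W_def using S finT by auto
  have "card W \<le> card (S \<times> {1..N'} \<times> T)"
    unfolding W_def using S finT by (intro card_image_le) auto
  also have "\<dots> = card S * (N' * card T)" by (simp add: card_cartesian_product)
  also have "\<dots> \<le> N' * (N' * (k * N) ^ M)" using S cardT by (intro mult_le_mono) auto
  finally have "card W < p" using large by simp
  with finW obtain z where z: "\<And>w. w \<in> W \<Longrightarrow> \<not> int p dvd w + z"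
    using exists_shift_avoiding_multiples by metis
  define U' where "U' = (\<lambda>a. a + z) ` S \<union> (\<lambda>(b, u). int b * u) ` ({1..N'} \<times> U)"
  have finU': "finite U'" unfolding U'_def using S U by auto
  have "card ((\<lambda>a. a + z) ` S) \<le> N'" using card_image_le[OF S(1)] S(2) le_trans by blast
  moreover have "card ((\<lambda>(b, u). int b * u) ` ({1..N'} \<times> U)) \<le> N' * N"
  proof -
    have "card ((\<lambda>(b, u). int b * u) ` ({1..N'} \<times> U)) \<le> card ({1..N'} \<times> U)"
      using U by (intro card_image_le) auto
    also have "\<dots> \<le> N' * N" using U by (simp add: card_cartesian_product)
    finally show ?thesis .
  qed
  ultimately have cardU': "card U' \<le> N' + N' * N"
    unfolding U'_def by (meson add_mono card_Un_le le_trans)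
  have "\<exists>y\<in>{..<Suc M} \<rightarrow> U'. \<exists>\<kappa>::nat \<Rightarrow> nat. \<forall>j<Suc M. \<forall>l\<in>{..<j} \<rightarrow> L.
           \<not> int p dvd y j + (\<Sum>i<j. l i * y i) \<and> c (y j + (\<Sum>i<j. l i * y i)) = \<kappa> j"
    if c: "\<forall>x. c x < r" for c :: "int \<Rightarrow> nat"
  proof -
    obtain a b \<kappa>0 where a: "a \<in> S" and b: "b \<in> {1..N'}"
      and \<kappa>0: "\<And>x. x \<in> T \<Longrightarrow> c (a + int b * x + z) = \<kappa>0"
      using homothety_setD[OF hom, of "\<lambda>x. c (x + z)"] c by auto
    \<comment> \<open>The lower levels are chosen after \<open>b\<close>, for the colouring dilated
      by \<open>b\<close>. Whatever the choice, their combinations lie in \<open>T\<close>, where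
      the colour \<open>\<kappa>0\<close> is already secured.\<close>
    have "\<forall>x. c (int b * x) < r" using c by simp
    then obtain y \<kappa> where y: "y \<in> {..<M} \<rightarrow> U"
      and ndvd: "\<And>j l. j < M \<Longrightarrow> l \<in> {..<j} \<rightarrow> L \<Longrightarrow> \<not> int p dvd y j + (\<Sum>i<j. l i * y i)"
      and \<kappa>: "\<And>j l. j < M \<Longrightarrow> l \<in> {..<j} \<rightarrow> L \<Longrightarrow> c (int b * (y j + (\<Sum>i<j. l i * y i))) = \<kappa> j"
      using layered_setD[OF lay, of "\<lambda>x. c (int b * x)"] by blast
    \<comment> \<open>Since \<open>1 \<le> b \<le> N' < p\<close>, dilation by \<open>b\<close>
      keeps the lower forms nonzero modulo \<open>p\<close>.\<close>
    have pb: "\<not> int p dvd int b"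
      using b large by (auto dest!: dvd_imp_le)
    define Y where "Y i = (if i < M then int b * y i else a + z)" for i
    have Yform: "(\<Sum>i<j. l i * Y i) = int b * (\<Sum>i<j. l i * y i)" if "j \<le> M" for j l
      unfolding sum_distrib_left using that by (intro sum.cong) (auto simp: Y_def)
    have "int b * y i \<in> U'" if "i < M" for i
      unfolding U'_def using that b y by (intro UnI2 image_eqI[where x = "(b, y i)"]) auto
    then have "Y \<in> {..<Suc M} \<rightarrow> U'"
      using a by (auto simp: Y_def U'_def)
    moreover have "\<not> int p dvd Y j + (\<Sum>i<j. l i * Y i) \<and>
        c (Y j + (\<Sum>i<j. l i * Y i)) = (\<kappa>(M := \<kappa>0)) j"
      if "j < Suc M" "l \<in> {..<j} \<rightarrow> L" for j l
    proof (cases "j < M")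
      case True
      have "Y j + (\<Sum>i<j. l i * Y i) = int b * (y j + (\<Sum>i<j. l i * y i))"
        using True by (simp add: Yform distrib_left) (simp add: Y_def)
      moreover have "\<not> int p dvd int b * (y j + (\<Sum>i<j. l i * y i))"
        using ndvd[OF True that(2)] pb p by (simp add: prime_dvd_mult_iff)
      ultimately show ?thesis using \<kappa>[OF True that(2)] True by simp
    next
      case False
      then have j: "j = M" using that by simp
      define v where "v = (\<Sum>i<M. l i * y i)"
      have v: "v \<in> T" unfolding v_def using TI y that(2) j by blast
      have "Y j + (\<Sum>i<j. l i * Y i) = a + int b * v + z"
        unfolding v_def j Yform[OF order_refl] by (simp add: Y_def)
      moreover have "a + int b * v \<in> W" unfolding W_def using a b v by force
      ultimately show ?thesis using z \<kappa>0[OF v] j by simp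
    qed
    ultimately show ?thesis by blast
  qed
  then have "layered_set p r (Suc M) (N' + N' * N) L U'"
    unfolding layered_set_def using finU' cardU' by blast
  then show ?thesis by blast
qed

lemma layered_set_exists:
  "\<exists>N. \<forall>p L. prime p \<and> N < p \<and> finite L \<and> card L \<le> k \<longrightarrow> (\<exists>U. layered_set p r M N L U)"
proof (induction M)
  case 0
  have "layered_set p r 0 0 L {}" for p L by (auto simp: layered_set_def)
  then show ?case by blast
next
  case (Suc M)
  then obtain N where N: "\<And>p L. prime p \<Longrightarrow> N < p \<Longrightarrow> finite L \<Longrightarrow> card L \<le> k \<Longrightarrow>
      \<exists>U. layered_set p r M N L U" by blast
  obtain N' where N': "\<And>T. finite T \<Longrightarrow> card T \<le> (k * N) ^ M \<Longrightarrow> \<exists>S. homothety_set r N' T S"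
    using homothety_set_exists[of "(k * N) ^ M" r] by blast
  \<comment> \<open>The summands serve, in order, the induction hypothesis, the room for the shift,
    and the size of the new set of values.\<close>
  define C where "C = N + (N' + N' * (N' * (k * N) ^ M)) + (N' + N' * N)"
  have "\<exists>U. layered_set p r (Suc M) C L U"
    if p: "prime p" "C < p" and L: "finite L" "card L \<le> k" for p L
  proof -
    obtain U where lay: "layered_set p r M N L U" using N[of p L] p L by (auto simp: C_def)
    then have U: "finite U" "card U \<le> N" by (auto simp: layered_set_def)
    define T where "T = (\<lambda>g. \<Sum>i<M. fst (g i) * snd (g i)) ` ({..<M} \<rightarrow>\<^sub>E L \<times> U)"
    have "finite T" "card T \<le> (k * N) ^ M"
      unfolding T_def using card_linear_combinations[OF L U] by auto
    then obtain S where S: "homothety_set r N' T S" using N' by blast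
    have "N' + N' * (N' * (k * N) ^ M) < p" using p(2) by (simp add: C_def)
    then obtain U' where "layered_set p r (Suc M) (N' + N' * N) L U'"
      using layered_set_Suc[OF lay L p(1) T_def S] by blast
    then have "layered_set p r (Suc M) C L U'"
      by (simp add: layered_set_def C_def)
    then show ?thesis by blast
  qed
  then show ?case by blast
qed

lemma monochromatic_layers_exist:
  fixes d r k :: nat
  shows "\<exists>N. \<forall>p L c. prime p \<and> N < p \<and> finite L \<and> card L \<le> k \<and> 0 \<in> L \<and> (\<forall>x::int. c x < r) \<longrightarrow>
     (\<exists>y \<kappa>. \<forall>j<d. \<forall>l\<in>{..<j} \<rightarrow> L.
        \<not> int p dvd y j + (\<Sum>i<j. l i * y i) \<and> c (y j + (\<Sum>i<j. l i * y i)) = (\<kappa>::nat))"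
proof -
  \<comment> \<open>Among \<open>r * d\<close> levels in \<open>r\<close> colours, some
    \<open>d\<close> share a colour.\<close>
  obtain N where N: "\<And>p L. prime p \<Longrightarrow> N < p \<Longrightarrow> finite L \<Longrightarrow> card L \<le> k \<Longrightarrow>
      \<exists>U. layered_set p r (r * d) N L U"
    using layered_set_exists[of k r "r * d"] by blast
  have "\<exists>y \<kappa>. \<forall>j<d. \<forall>l\<in>{..<j} \<rightarrow> L.
        \<not> int p dvd y j + (\<Sum>i<j. l i * y i) \<and> c (y j + (\<Sum>i<j. l i * y i)) = (\<kappa>::nat)"
    if p: "prime p" "N < p" and L: "finite L" "card L \<le> k" "0 \<in> L" and c: "\<forall>x. c x < r"
    for p L and c :: "int \<Rightarrow> nat"
  proof -
    obtain U where lay: "layered_set p r (r * d) N L U" using N[of p L] p L by auto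
    obtain y \<kappa> where
      ndvd: "\<And>j l. j < r * d \<Longrightarrow> l \<in> {..<j} \<rightarrow> L \<Longrightarrow> \<not> int p dvd y j + (\<Sum>i<j. l i * y i)"
      and \<kappa>: "\<And>j l. j < r * d \<Longrightarrow> l \<in> {..<j} \<rightarrow> L \<Longrightarrow> c (y j + (\<Sum>i<j. l i * y i)) = \<kappa> j"
      using layered_setD[OF lay c] by blast
    have r: "r > 0" using c by (metis gr_zeroI not_less_zero)
    \<comment> \<open>Zero coefficients exhibit \<open>\<kappa> j\<close> as a value of
      \<open>c\<close>.\<close>
    have "\<kappa> \<in> {..<r * d} \<rightarrow> {..<r}"
    proof
      fix j assume "j \<in> {..<r * d}"
      then have "\<kappa> j = c (y j + (\<Sum>i<j. 0 * y i))" using \<kappa>[of j "\<lambda>_. 0"] L by simp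
      then show "\<kappa> j \<in> {..<r}" using c by simp
    qed
    then obtain v where "card (\<kappa> -` {v} \<inter> {..<r * d}) * r \<ge> r * d"
      using pigeonhole_card[of \<kappa> "{..<r * d}" "{..<r}"] r by auto
    then have "d \<le> card (\<kappa> -` {v} \<inter> {..<r * d})" using r by (simp add: mult.commute)
    then obtain J where J: "J \<subseteq> \<kappa> -` {v} \<inter> {..<r * d}" "card J = d" "finite J"
      using obtain_subset_with_card_n by metis
    \<comment> \<open>An increasing enumeration keeps lower levels lower, so a form in the chosen
      levels is a form of the whole system with coefficient \<open>0\<close> elsewhere.\<close>
    then obtain e where e: "bij_betw e {..<d} J" "strict_mono_on {..<d} e"
      using ex_bij_betw_strict_mono_card by metis
    have "\<not> int p dvd y (e j) + (\<Sum>i<j. l i * y (e i)) \<and>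
        c (y (e j) + (\<Sum>i<j. l i * y (e i))) = v"
      if j: "j < d" and l: "l \<in> {..<j} \<rightarrow> L" for j l
    proof -
      have ej: "e j < r * d" "\<kappa> (e j) = v" using bij_betwE[OF e(1)] J(1) j by auto
      have less: "e i < e j" if "i < j" for i
        using strict_mono_onD[OF e(2)] that j by auto
      have inj: "inj_on e {..<j}"
        using bij_betw_imp_inj_on[OF e(1)] by (rule inj_on_subset) (use j in auto)
      define l' where "l' q = (if q \<in> e ` {..<j} then l (inv_into {..<j} e q) else 0)" for q
      have l': "l' \<in> {..<e j} \<rightarrow> L"
        using funcset_mem[OF l] L(3) inj by (auto simp: l'_def)
      have "(\<Sum>q<e j. l' q * y q) = (\<Sum>q\<in>e ` {..<j}. l' q * y q)"
        using less by (intro sum.mono_neutral_right) (auto simp: l'_def)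
      also have "\<dots> = (\<Sum>i<j. l i * y (e i))"
        using inj by (subst sum.reindex) (auto simp: l'_def intro!: sum.cong)
      finally show ?thesis using ndvd[OF ej(1) l'] \<kappa>[OF ej(1) l'] ej(2) by simp
    qed
    then show ?thesis by (intro exI[of _ "\<lambda>i. y (e i)"] exI[of _ v]) blast
  qed
  then show ?thesis by blast
qed

section \<open>The columns condition modulo a prime\<close>

text \<open>Integer congruences stand in for linear algebra over the residue ring, so coefficients
  need no reduction.\<close>

definition in_span_mod :: "nat \<Rightarrow> nat \<Rightarrow> (nat \<Rightarrow> nat \<Rightarrow> int) \<Rightarrow> nat set \<Rightarrow> (nat \<Rightarrow> int) \<Rightarrow> bool" where
  "in_span_mod p n A S v \<longleftrightarrow> (\<exists>t. \<forall>i\<in>{1..n}. [v i = (\<Sum>c\<in>S. t c * A i c)] (mod int p))"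

lemma in_span_mod_mono:
  assumes "in_span_mod p n A S v" and "S \<subseteq> S'" and "finite S'"
  shows "in_span_mod p n A S' v"
proof -
  obtain t where t: "\<And>i. i \<in> {1..n} \<Longrightarrow> [v i = (\<Sum>c\<in>S. t c * A i c)] (mod int p)"
    using assms(1) unfolding in_span_mod_def by blast
  have "(\<Sum>c\<in>S'. (if c \<in> S then t c else 0) * A i c) = (\<Sum>c\<in>S. t c * A i c)" for i
    using assms(2,3) by (intro sum.mono_neutral_cong_right) auto
  then show ?thesis
    unfolding in_span_mod_def using t by (intro exI[of _ "\<lambda>c. if c \<in> S then t c else 0"]) simp
qed

lemma in_span_mod_column:
  assumes "c \<in> S" and "finite S"
  shows "in_span_mod p n A S (\<lambda>i. A i c)"
proof -
  have "(\<Sum>d\<in>S. (if d = c then 1 else 0) * A i d) = A i c" for i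
    using assms by (simp add: if_distrib[of "\<lambda>x. x * _"] cong: if_cong)
  then show ?thesis
    unfolding in_span_mod_def by (intro exI[of _ "\<lambda>d. if d = c then 1 else 0"]) simp
qed

lemma in_span_mod_trans:
  assumes "in_span_mod p n A S v" and "\<And>c. c \<in> S \<Longrightarrow> in_span_mod p n A T (\<lambda>i. A i c)"
  shows "in_span_mod p n A T v"
proof -
  obtain t where t: "\<And>i. i \<in> {1..n} \<Longrightarrow> [v i = (\<Sum>c\<in>S. t c * A i c)] (mod int p)"
    using assms(1) unfolding in_span_mod_def by blast
  obtain u where u: "\<And>c i. c \<in> S \<Longrightarrow> i \<in> {1..n} \<Longrightarrow> [A i c = (\<Sum>d\<in>T. u c d * A i d)] (mod int p)"
    using assms(2) unfolding in_span_mod_def by metis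
  have "[v i = (\<Sum>d\<in>T. (\<Sum>c\<in>S. t c * u c d) * A i d)] (mod int p)" if i: "i \<in> {1..n}" for i
  proof -
    have "[(\<Sum>c\<in>S. t c * A i c) = (\<Sum>c\<in>S. t c * (\<Sum>d\<in>T. u c d * A i d))] (mod int p)"
      using u i by (intro cong_sum cong_scalar_left) auto
    also have "(\<Sum>c\<in>S. t c * (\<Sum>d\<in>T. u c d * A i d)) = (\<Sum>d\<in>T. (\<Sum>c\<in>S. t c * u c d) * A i d)"
      unfolding sum_distrib_left sum_distrib_right by (subst sum.swap) (simp add: mult.assoc)
    finally show ?thesis using t[OF i] cong_trans by blast
  qed
  then show ?thesis
    unfolding in_span_mod_def by (intro exI[of _ "\<lambda>d. \<Sum>c\<in>S. t c * u c d"]) blast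
qed

section \<open>Greedy bases modulo a prime\<close>

locale ranked_columns =
  fixes p n :: nat and A :: "nat \<Rightarrow> nat \<Rightarrow> int" and E :: "nat set" and \<rho> :: "nat \<Rightarrow> nat"
  assumes prime: "prime p" and fin: "finite E" and inj: "inj_on \<rho> E"
begin

text \<open>The columns kept by greedy selection in the order of \<open>\<rho>\<close>.\<close>

definition basis :: "nat set" where
  "basis = {c \<in> E. \<not> in_span_mod p n A {d \<in> E. \<rho> d < \<rho> c} (\<lambda>i. A i c)}"

lemma finite_basis: "finite basis"
  using fin by (simp add: basis_def)

text \<open>Induction along \<open>\<rho>\<close>: a rejected column is spanned by earlier ones. The
  bound on ranks later confines each block sum to basis columns of earlier blocks.\<close>

lemma in_span_basis:
  "c \<in> E \<Longrightarrow> in_span_mod p n A {b \<in> basis. \<rho> b \<le> \<rho> c} (\<lambda>i. A i c)"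
proof (induction "\<rho> c" arbitrary: c rule: less_induct)
  case less
  show ?case
  proof (cases "c \<in> basis")
    case True
    then show ?thesis using finite_basis by (intro in_span_mod_column) auto
  next
    case False
    then have "in_span_mod p n A {d \<in> E. \<rho> d < \<rho> c} (\<lambda>i. A i c)"
      using less.prems by (simp add: basis_def)
    then show ?thesis
    proof (rule in_span_mod_trans)
      fix d assume "d \<in> {d \<in> E. \<rho> d < \<rho> c}"
      then show "in_span_mod p n A {b \<in> basis. \<rho> b \<le> \<rho> c} (\<lambda>i. A i d)"
        using less.hyps[of d] finite_basis by (auto intro: in_span_mod_mono)
    qed
  qed
qed

text \<open>At the top-ranked column where \<open>s\<close> and \<open>t\<close> differ, the
  difference of coefficients is invertible modulo \<open>p\<close>; solving for that column puts it
  in the span of earlier ones.\<close>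

lemma basis_independent:
  assumes s: "s \<in> basis \<rightarrow>\<^sub>E {0..<int p}" and t: "t \<in> basis \<rightarrow>\<^sub>E {0..<int p}"
    and eq: "\<And>i. i \<in> {1..n} \<Longrightarrow> [(\<Sum>c\<in>basis. s c * A i c) = (\<Sum>c\<in>basis. t c * A i c)] (mod int p)"
  shows "s = t"
proof (rule ccontr)
  assume "s \<noteq> t"
  define D where "D = {c \<in> basis. s c \<noteq> t c}"
  have D: "finite D" unfolding D_def using finite_basis by simp
  have DE: "D \<subseteq> E" by (auto simp: D_def basis_def)
  have "D \<noteq> {}" using PiE_ext[OF s t] \<open>s \<noteq> t\<close> unfolding D_def by blast
  then have "Max (\<rho> ` D) \<in> \<rho> ` D" using D by (intro Max_in) auto
  then obtain c where c: "c \<in> D" "\<rho> c = Max (\<rho> ` D)" by auto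
  then have max: "\<rho> d \<le> \<rho> c" if "d \<in> D" for d using that D by simp
  have less: "D - {c} \<subseteq> {d \<in> E. \<rho> d < \<rho> c}"
  proof
    fix d assume d: "d \<in> D - {c}"
    then have "\<rho> d \<noteq> \<rho> c" using inj_onD[OF inj, of d c] DE c(1) by blast
    then show "d \<in> {d \<in> E. \<rho> d < \<rho> c}" using max[of d] d DE by auto
  qed
  have cb: "c \<in> basis" using c by (simp add: D_def)
  have "s c \<in> {0..<int p}" "t c \<in> {0..<int p}" "s c \<noteq> t c"
    using s t cb c by (auto simp: D_def PiE_def Pi_def)
  then have "\<not> int p dvd s c - t c"
    using zdvd_imp_le[of "int p" "s c - t c"] zdvd_imp_le[of "int p" "t c - s c"]
    by (auto simp: dvd_diff_commute[of _ "s c"] linorder_neq_iff)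
  then have "coprime (s c - t c) (int p)"
    using prime by (simp add: coprime_commute prime_imp_coprime)
  then obtain w where w: "[(s c - t c) * w = 1] (mod int p)"
    using cong_solve_coprime_int by blast
  have "[A i c = (\<Sum>d\<in>D - {c}. - (w * (s d - t d)) * A i d)] (mod int p)" if i: "i \<in> {1..n}" for i
  proof -
    have "(\<Sum>d\<in>basis. (s d - t d) * A i d) = (\<Sum>d\<in>D. (s d - t d) * A i d)"
      using finite_basis by (intro sum.mono_neutral_right) (auto simp: D_def)
    also have "\<dots> = (s c - t c) * A i c + (\<Sum>d\<in>D - {c}. (s d - t d) * A i d)"
      using D c by (intro sum.remove) auto
    finally have "int p dvd (s c - t c) * A i c + (\<Sum>d\<in>D - {c}. (s d - t d) * A i d)"
      using eq[OF i] by (simp add: cong_iff_dvd_diff sum_subtractf left_diff_distrib)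
    then have "int p dvd w * ((s c - t c) * A i c + (\<Sum>d\<in>D - {c}. (s d - t d) * A i d))"
      by (rule dvd_mult)
    moreover have "int p dvd ((s c - t c) * w - 1) * A i c"
      using w by (simp add: cong_iff_dvd_diff)
    ultimately have "int p dvd w * ((s c - t c) * A i c + (\<Sum>d\<in>D - {c}. (s d - t d) * A i d))
        - ((s c - t c) * w - 1) * A i c"
      by (rule dvd_diff)
    also have "\<dots> = A i c - (\<Sum>d\<in>D - {c}. - (w * (s d - t d)) * A i d)"
      by (simp add: algebra_simps sum_distrib_left sum_negf sum_subtractf)
    finally show ?thesis by (simp add: cong_iff_dvd_diff)
  qed
  then have "in_span_mod p n A (D - {c}) (\<lambda>i. A i c)"
    unfolding in_span_mod_def by (intro exI[of _ "\<lambda>d. - (w * (s d - t d))"]) blast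
  then have "in_span_mod p n A {d \<in> E. \<rho> d < \<rho> c} (\<lambda>i. A i c)"
    using less fin by (auto intro: in_span_mod_mono)
  then show False using cb by (simp add: basis_def)
qed

text \<open>The basis has at most \<open>n\<close> elements since its \<open>p ^ card basis\<close> linear combinations are
  distinct vectors of a space of size \<open>p ^ n\<close>.\<close>

lemma card_basis: "card basis \<le> n"
proof -
  define f where "f t = (\<lambda>i\<in>{1..n}. (\<Sum>c\<in>basis. t c * A i c) mod int p)" for t
  have p: "p > 1" using prime prime_gt_1_nat by blast
  have "inj_on f (basis \<rightarrow>\<^sub>E {0..<int p})"
  proof (rule inj_onI)
    fix s t assume st: "s \<in> basis \<rightarrow>\<^sub>E {0..<int p}" "t \<in> basis \<rightarrow>\<^sub>E {0..<int p}" and "f s = f t"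
    have "[(\<Sum>c\<in>basis. s c * A i c) = (\<Sum>c\<in>basis. t c * A i c)] (mod int p)" if "i \<in> {1..n}" for i
    proof -
      have "f s i = f t i" using \<open>f s = f t\<close> by simp
      then show ?thesis using that by (simp add: f_def cong_def)
    qed
    with st show "s = t" by (rule basis_independent)
  qed
  moreover have "f ` (basis \<rightarrow>\<^sub>E {0..<int p}) \<subseteq> {1..n} \<rightarrow>\<^sub>E {0..<int p}"
    using p by (auto simp: f_def)
  ultimately have "card (basis \<rightarrow>\<^sub>E {0..<int p}) \<le> card ({1..n} \<rightarrow>\<^sub>E {0..<int p})"
    by (rule card_inj_on_le) (auto intro: finite_PiE)
  then have "p ^ card basis \<le> p ^ n" using finite_basis by (simp add: card_PiE)
  then show ?thesis using p by simp
qed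

end

section \<open>Solutions parametrised by boundedly many levels\<close>

text \<open>The terms in \<open>y s\<close> contribute the column sum of level \<open>s\<close>,
  which is a combination of basis columns with coefficients \<open>T s b\<close>; the corrections
  \<open>- T s b\<close> on the basis columns cancel it.\<close>

lemma parametric_solution:
  fixes A :: "nat \<Rightarrow> nat \<Rightarrow> int" and blk :: "nat \<Rightarrow> nat"
  assumes prime: "prime p"
    and cols: "\<And>j. in_span_mod p n A {c \<in> {1..m}. blk c < j} (\<lambda>i. \<Sum>c | c \<in> {1..m} \<and> blk c = j. A i c)"
  obtains lev :: "nat \<Rightarrow> nat" and L :: "int set" and q :: "nat \<Rightarrow> nat \<Rightarrow> int"
  where "\<And>c. lev c \<le> n" and "finite L" and "card L \<le> Suc (Suc n * n)" and "0 \<in> L"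
    and "\<And>c s. s \<le> n \<Longrightarrow> q c s \<in> L"
    and "\<And>y i. i \<in> {1..n} \<Longrightarrow>
           int p dvd (\<Sum>c\<in>{1..m}. A i c * (y (lev c) + (\<Sum>s<lev c. q c s * y s)))"
proof -
  define E where "E = {1..m}"
  \<comment> \<open>Lexicographic order by block and then by column, as columns are at most
    \<open>m\<close>.\<close>
  define \<rho> where "\<rho> c = blk c * Suc m + c" for c
  have \<rho>_blk: "blk b \<le> blk c" if "\<rho> b \<le> \<rho> c" "c \<in> E" for b c
  proof (rule ccontr)
    assume "\<not> blk b \<le> blk c"
    then have "Suc (blk c) * Suc m \<le> blk b * Suc m" by (intro mult_le_mono1) simp
    with that show False by (simp add: \<rho>_def E_def)
  qed
  interpret ranked_columns p n A E \<rho>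
  proof
    show "inj_on \<rho> E"
    proof (rule inj_onI)
      fix b c assume bc: "b \<in> E" "c \<in> E" "\<rho> b = \<rho> c"
      then have "blk b = blk c" using \<rho>_blk[of b c] \<rho>_blk[of c b] by simp
      with bc show "b = c" by (simp add: \<rho>_def)
    qed
  qed (use prime in \<open>auto simp: E_def\<close>)
  have "in_span_mod p n A {b \<in> basis. blk b < j} (\<lambda>i. \<Sum>c | c \<in> E \<and> blk c = j. A i c)" for j
  proof (rule in_span_mod_trans[OF cols[of j, folded E_def]])
    fix c assume c: "c \<in> {c \<in> E. blk c < j}"
    then have "{b \<in> basis. \<rho> b \<le> \<rho> c} \<subseteq> {b \<in> basis. blk b < j}" using \<rho>_blk by fastforce
    then show "in_span_mod p n A {b \<in> basis. blk b < j} (\<lambda>i. A i c)"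
      using in_span_mod_mono[OF in_span_basis] c finite_basis by auto
  qed
  then have "\<forall>j. \<exists>t. \<forall>i\<in>{1..n}.
      [(\<Sum>c | c \<in> E \<and> blk c = j. A i c) = (\<Sum>b | b \<in> basis \<and> blk b < j. t b * A i b)] (mod int p)"
    by (simp add: in_span_mod_def)
  from choice[OF this] obtain t where t: "\<And>j i. i \<in> {1..n} \<Longrightarrow>
      [(\<Sum>c | c \<in> E \<and> blk c = j. A i c) = (\<Sum>b | b \<in> basis \<and> blk b < j. t j b * A i b)] (mod int p)"
    by blast
  txt \<open>Blocks between two consecutive blocks of basis columns get the same level, and earlier
    blocks get higher levels.\<close>
  define blev where "blev j = card {k \<in> blk ` basis. j \<le> k}" for j
  define lev where "lev c = blev (blk c)" for c
  \<comment> \<open>The coefficients of \<open>b\<close> are added up over all blocks merged into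
    level \<open>s\<close>.\<close>
  define T where "T s b = (\<Sum>j | j \<in> blk ` E \<and> blev j = s \<and> blk b < j. t j b)" for s b
  define q where "q c s = (if c \<in> basis then - T s c else 0)" for c s
  \<comment> \<open>One coefficient for each of \<open>n + 1\<close> levels and at most
    \<open>n\<close> basis columns, plus \<open>0\<close>: neither \<open>m\<close> nor
    \<open>p\<close> enters the count.\<close>
  define L where "L = insert 0 ((\<lambda>(s, b). - T s b) ` ({..n} \<times> basis))"
  have lev_le: "lev c \<le> n" for c
  proof -
    have "lev c \<le> card (blk ` basis)"
      unfolding lev_def blev_def using finite_basis by (intro card_mono) auto
    also have "\<dots> \<le> card basis" using finite_basis by (rule card_image_le)
    finally show ?thesis using card_basis by simp
  qed
  have finL: "finite L" unfolding L_def using finite_basis by simp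
  have "card ((\<lambda>(s, b). - T s b) ` ({..n} \<times> basis)) \<le> card ({..n} \<times> basis)"
    using finite_basis by (intro card_image_le) auto
  also have "\<dots> \<le> Suc n * n"
    unfolding card_cartesian_product card_atMost using card_basis by (rule mult_le_mono2)
  finally have cardL: "card L \<le> Suc (Suc n * n)"
    unfolding L_def using finite_basis by (simp add: card_insert_if)
  have qL: "q c s \<in> L" if "s \<le> n" for c s
    using that by (auto simp: q_def L_def)
  \<comment> \<open>A block after that of \<open>b\<close> has strictly lower level, because the
    block of \<open>b\<close> itself is no longer counted.\<close>
  have T0: "T s b = 0" if "b \<in> basis" "lev b \<le> s" for s b
  proof -
    have "blev j < lev b" if "blk b < j" for j
      unfolding lev_def blev_def
    proof (rule psubset_card_mono)
      show "finite {k \<in> blk ` basis. blk b \<le> k}" using finite_basis by simp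
      show "{k \<in> blk ` basis. j \<le> k} \<subset> {k \<in> blk ` basis. blk b \<le> k}"
      proof -
        have "blk b \<in> {k \<in> blk ` basis. blk b \<le> k}" "blk b \<notin> {k \<in> blk ` basis. j \<le> k}"
          using \<open>b \<in> basis\<close> that by auto
        moreover have "{k \<in> blk ` basis. j \<le> k} \<subseteq> {k \<in> blk ` basis. blk b \<le> k}"
          using that by auto
        ultimately show ?thesis by blast
      qed
    qed
    then have "{j. j \<in> blk ` E \<and> blev j = s \<and> blk b < j} = {}" using that(2) by force
    then show ?thesis unfolding T_def by (simp only: sum.empty)
  qed
  have level_sum: "[(\<Sum>c | c \<in> E \<and> lev c = s. A i c) = (\<Sum>b\<in>basis. T s b * A i b)] (mod int p)"
    if i: "i \<in> {1..n}" for i s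
  proof -
    define J where "J = {j \<in> blk ` E. blev j = s}"
    have finJ: "finite J" using fin by (simp add: J_def)
    have "(\<Sum>c | c \<in> E \<and> lev c = s. A i c) = (\<Sum>j\<in>J. \<Sum>c | c \<in> {c \<in> E. lev c = s} \<and> blk c = j. A i c)"
      using fin finJ by (intro sum.group[symmetric]) (auto simp: J_def lev_def)
    also have "\<dots> = (\<Sum>j\<in>J. \<Sum>c | c \<in> E \<and> blk c = j. A i c)"
      by (intro sum.cong refl) (auto simp: J_def lev_def)
    also have "[\<dots> = (\<Sum>j\<in>J. \<Sum>b | b \<in> basis \<and> blk b < j. t j b * A i b)] (mod int p)"
      using t[OF i] by (intro cong_sum) auto
    also have "(\<Sum>j\<in>J. \<Sum>b | b \<in> basis \<and> blk b < j. t j b * A i b)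
        = (\<Sum>b\<in>basis. \<Sum>j | j \<in> J \<and> blk b < j. t j b * A i b)"
      using finJ finite_basis by (rule sum.swap_restrict)
    also have "\<dots> = (\<Sum>b\<in>basis. T s b * A i b)"
      by (simp add: T_def J_def sum_distrib_right conj_assoc)
    finally show ?thesis .
  qed
  have "int p dvd (\<Sum>c\<in>E. A i c * (y (lev c) + (\<Sum>s<lev c. q c s * y s)))"
    if i: "i \<in> {1..n}" for y i
  proof -
    have "(\<Sum>c\<in>E. A i c * y (lev c)) = (\<Sum>s\<le>n. \<Sum>c | c \<in> E \<and> lev c = s. A i c * y (lev c))"
      using fin lev_le by (intro sum.group[symmetric]) auto
    also have "\<dots> = (\<Sum>s\<le>n. (\<Sum>c | c \<in> E \<and> lev c = s. A i c) * y s)"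
      by (simp add: sum_distrib_right)
    also have "[\<dots> = (\<Sum>s\<le>n. (\<Sum>b\<in>basis. T s b * A i b) * y s)] (mod int p)"
      using level_sum[OF i] by (intro cong_sum cong_scalar_right) auto
    also have "(\<Sum>s\<le>n. (\<Sum>b\<in>basis. T s b * A i b) * y s) = (\<Sum>b\<in>basis. \<Sum>s\<le>n. A i b * (T s b * y s))"
      unfolding sum_distrib_right by (subst sum.swap) (simp add: mult_ac)
    also have "\<dots> = (\<Sum>b\<in>basis. A i b * (\<Sum>s<lev b. T s b * y s))"
    proof (intro sum.cong refl)
      fix b assume b: "b \<in> basis"
      have "(\<Sum>s\<le>n. T s b * y s) = (\<Sum>s<lev b. T s b * y s)"
        using lev_le[of b] T0[OF b] by (intro sum.mono_neutral_right) auto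
      then show "(\<Sum>s\<le>n. A i b * (T s b * y s)) = A i b * (\<Sum>s<lev b. T s b * y s)"
        by (simp add: sum_distrib_left[symmetric])
    qed
    also have "\<dots> = - (\<Sum>b\<in>basis. A i b * (\<Sum>s<lev b. q b s * y s))"
      by (simp add: q_def sum_negf)
    also have "(\<Sum>b\<in>basis. A i b * (\<Sum>s<lev b. q b s * y s)) = (\<Sum>c\<in>E. A i c * (\<Sum>s<lev c. q c s * y s))"
      using fin by (intro sum.mono_neutral_left) (auto simp: q_def basis_def)
    finally show ?thesis
      by (simp add: cong_iff_dvd_diff distrib_left sum.distrib)
  qed
  then show thesis
    using that[of lev L q] lev_le finL cardL qL unfolding L_def E_def by simp
qed

section \<open>From the residue ring to integer congruences\<close>

lemma columns_condition_residue_ring: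
  assumes p: "prime p" and A: "is_matrix (residue_ring (int p)) n m A"
    and cc: "columns_condition (residue_ring (int p)) n m A"
  obtains blk :: "nat \<Rightarrow> nat" where
    "\<And>j. in_span_mod p n A {c \<in> {1..m}. blk c < j} (\<lambda>i. \<Sum>c | c \<in> {1..m} \<and> blk c = j. A i c)"
proof -
  define R where "R = residue_ring (int p)"
  interpret residues "int p" R
    by unfold_locales (use p prime_gt_1_nat in \<open>auto simp: R_def\<close>)
  obtain d :: nat and P where part: "partition_on {1..m} (P ` {1..d})" and inj: "inj_on P {1..d}"
    and span: "\<And>j. j \<in> {1..d} \<Longrightarrow> col_sum R n A (P j) \<in> col_span R n A (\<Union>k\<in>{1..<j}. P k)"
    using cc unfolding columns_condition_def R_def by blast
  have cover: "(\<Union>k\<in>{1..d}. P k) = {1..m}" using partition_onD1[OF part] by simp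
  have disj: "j = k" if "j \<in> {1..d}" "k \<in> {1..d}" "c \<in> P j" "c \<in> P k" for j k c
  proof (rule ccontr)
    assume "j \<noteq> k"
    then have "P j \<noteq> P k" using inj_onD[OF inj] that(1,2) by blast
    then have "P j \<inter> P k = {}"
      using disjointD[OF partition_onD2[OF part]] that(1,2) by blast
    then show False using that(3,4) by blast
  qed
  have "\<exists>j. j \<in> {1..d} \<and> c \<in> P j" if "c \<in> {1..m}" for c
    using that cover by blast
  then obtain blk where blk: "\<And>c. c \<in> {1..m} \<Longrightarrow> blk c \<in> {1..d} \<and> c \<in> P (blk c)"
    by metis
  have P: "P j = {c \<in> {1..m}. blk c = j}" if "j \<in> {1..d}" for j
  proof (intro equalityI subsetI)
    fix c assume c: "c \<in> P j"
    then have "c \<in> {1..m}" using cover that by blast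
    then show "c \<in> {c \<in> {1..m}. blk c = j}" using disj[OF _ that _ c] blk by blast
  qed (use blk in blast)
  have "in_span_mod p n A {c \<in> {1..m}. blk c < j} (\<lambda>i. \<Sum>c | c \<in> {1..m} \<and> blk c = j. A i c)" for j
  proof (cases "j \<in> {1..d}")
    case False
    \<comment> \<open>Indices outside \<open>{1..d}\<close> name empty blocks, whose sum is
      zero.\<close>
    then have empty: "{c. c \<in> {1..m} \<and> blk c = j} = {}" using blk by blast
    show ?thesis
      unfolding in_span_mod_def empty by (intro exI[of _ "\<lambda>_. 0"]) simp
  next
    case True
    have below: "(\<Union>k\<in>{1..<j}. P k) = {c \<in> {1..m}. blk c < j}"
    proof (intro equalityI subsetI)
      fix c assume "c \<in> (\<Union>k\<in>{1..<j}. P k)"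
      then obtain k where "k \<in> {1..<j}" "c \<in> P k" by blast
      then show "c \<in> {c \<in> {1..m}. blk c < j}" using P[of k] True by auto
    next
      fix c assume "c \<in> {c \<in> {1..m}. blk c < j}"
      then show "c \<in> (\<Union>k\<in>{1..<j}. P k)" using blk[of c] by auto
    qed
    obtain t where t: "col_sum R n A (P j) =
        (\<lambda>i\<in>{1..n}. \<Oplus>\<^bsub>R\<^esub>c\<in>{c \<in> {1..m}. blk c < j}. t c \<otimes>\<^bsub>R\<^esub> A i c)"
      using span[OF True] unfolding col_span_def below by blast
    have "[(\<Sum>c | c \<in> {1..m} \<and> blk c = j. A i c) = (\<Sum>c | c \<in> {1..m} \<and> blk c < j. t c * A i c)] (mod int p)"
      if i: "i \<in> {1..n}" for i
    proof -
      \<comment> \<open>Entries are their own residues, so the ring sum can be written with reduced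
        summands and read as one integer sum modulo \<open>p\<close>.\<close>
      have "A i c mod int p = A i c" if "c \<in> {1..m}" for c
        using A i that unfolding is_matrix_def by (auto simp: residue_ring_def)
      then have "(\<Oplus>\<^bsub>R\<^esub>c\<in>P j. A i c) = (\<Oplus>\<^bsub>R\<^esub>c\<in>P j. A i c mod int p)"
        using P[OF True] A i
        by (intro add.finprod_cong') (auto simp: is_matrix_def R_def)
      also have "\<dots> = (\<Sum>c | c \<in> {1..m} \<and> blk c = j. A i c) mod int p"
        using P[OF True] by (simp add: sum_cong)
      finally have lhs: "col_sum R n A (P j) i = \<dots>" using i by (simp add: col_sum_def)
      have "col_sum R n A (P j) i = (\<Sum>c | c \<in> {1..m} \<and> blk c < j. t c * A i c) mod int p"
        using i by (simp add: t res_mult_eq sum_cong)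
      with lhs show ?thesis by (simp add: cong_def)
    qed
    then show ?thesis unfolding in_span_mod_def by blast
  qed
  then show thesis using that by blast
qed

section \<open>Monochromatic solutions for all large primes\<close>

theorem theorem1p2:
  fixes n r :: nat
  assumes "n \<ge> 1" and "r \<ge> 1"
  shows "\<exists>C::nat. \<forall>(p::nat) (m::nat) (A::nat \<Rightarrow> nat \<Rightarrow> int) (\<chi>::int \<Rightarrow> nat).
           prime p \<longrightarrow>
           is_matrix (residue_ring (int p)) n m A \<longrightarrow>
           columns_condition (residue_ring (int p)) n m A \<longrightarrow>
           \<chi> \<in> carrier (residue_ring (int p)) - {\<zero>\<^bsub>residue_ring (int p)\<^esub>} \<rightarrow> {1..r} \<longrightarrow>
           (\<nexists>x. monochromatic_solution (residue_ring (int p)) n m A \<chi> x) \<longrightarrow>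
           p \<le> C"
proof -
  \<comment> \<open>Levels run from \<open>0\<close> to \<open>n\<close>, hence \<open>Suc n\<close>
    layers; \<open>Suc (Suc n * n)\<close> is the number of coefficients allowed by
    \<open>parametric_solution\<close>.\<close>
  obtain N where N: "\<forall>p L c. prime p \<and> N < p \<and> finite L \<and> card L \<le> Suc (Suc n * n) \<and> 0 \<in> L \<and>
      (\<forall>x::int. c x < r) \<longrightarrow>
      (\<exists>y \<kappa>. \<forall>j<Suc n. \<forall>l\<in>{..<j} \<rightarrow> L.
        \<not> int p dvd y j + (\<Sum>i<j. l i * y i) \<and> c (y j + (\<Sum>i<j. l i * y i)) = (\<kappa>::nat))"
    by (rule exE[OF monochromatic_layers_exist])
  have "\<exists>x. monochromatic_solution (residue_ring (int p)) n m A \<chi> x"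
    if p: "prime p" "N < p" and A: "is_matrix (residue_ring (int p)) n m A"
      and cc: "columns_condition (residue_ring (int p)) n m A"
      and \<chi>: "\<chi> \<in> carrier (residue_ring (int p)) - {\<zero>\<^bsub>residue_ring (int p)\<^esub>} \<rightarrow> {1..r}"
    for p m A and \<chi> :: "int \<Rightarrow> nat"
  proof -
    define R where "R = residue_ring (int p)"
    interpret residues "int p" R
      by unfold_locales (use p prime_gt_1_nat in \<open>auto simp: R_def\<close>)
    obtain blk :: "nat \<Rightarrow> nat" where blk: "\<And>j. in_span_mod p n A {c \<in> {1..m}. blk c < j}
        (\<lambda>i. \<Sum>c | c \<in> {1..m} \<and> blk c = j. A i c)"
      using columns_condition_residue_ring[OF p(1) A cc] by blast
    obtain lev L q where lev: "\<And>c. lev c \<le> n"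
      and L: "finite L" "card L \<le> Suc (Suc n * n)" "0 \<in> L" and q: "\<And>c s. s \<le> n \<Longrightarrow> q c s \<in> L"
      and sol: "\<And>y i. i \<in> {1..n} \<Longrightarrow>
           int p dvd (\<Sum>c\<in>{1..m}. A i c * (y (lev c) + (\<Sum>s<lev c. q c s * y s)))"
      by (rule parametric_solution[OF p(1) blk]) blast
    have unit: "x mod int p \<in> carrier R - {\<zero>\<^bsub>R\<^esub>}" if "\<not> int p dvd x" for x
      using that by (auto simp: res_zero_eq dvd_eq_mod_eq_0)
    \<comment> \<open>The colouring is lifted to all integers and shifted from \<open>{1..r}\<close>
      to \<open>{..<r}\<close>. Multiples of \<open>p\<close> get the dummy colour \<open>0\<close>,
      harmless because the forms avoid them.\<close>
    define c where "c x = (if int p dvd x then 0 else \<chi> (x mod int p) - 1)" for x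
    have \<chi>_unit: "\<chi> (x mod int p) \<in> {1..r}" if "\<not> int p dvd x" for x
      using funcset_mem[OF \<chi>[folded R_def] unit[OF that]] .
    have "c x < r" for x
      using \<chi>_unit[of x] assms(2) by (auto simp: c_def)
    with p L have "prime p \<and> N < p \<and> finite L \<and> card L \<le> Suc (Suc n * n) \<and> 0 \<in> L \<and> (\<forall>x. c x < r)"
      by blast
    from N[THEN spec, THEN spec, THEN spec, THEN mp, OF this] obtain y \<kappa> where y: "\<And>j l. j < Suc n \<Longrightarrow> l \<in> {..<j} \<rightarrow> L \<Longrightarrow>
        \<not> int p dvd y j + (\<Sum>i<j. l i * y i) \<and> c (y j + (\<Sum>i<j. l i * y i)) = \<kappa>"
      by blast
    define z where "z k = y (lev k) + (\<Sum>s<lev k. q k s * y s)" for k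
    have z: "\<not> int p dvd z k \<and> c (z k) = \<kappa>" for k
      unfolding z_def using lev[of k] q by (intro y) auto
    have "(\<Oplus>\<^bsub>R\<^esub>j\<in>{1..m}. A i j \<otimes>\<^bsub>R\<^esub> (z j mod int p)) = \<zero>\<^bsub>R\<^esub>" if i: "i \<in> {1..n}" for i
    proof -
      have "(\<Oplus>\<^bsub>R\<^esub>j\<in>{1..m}. A i j \<otimes>\<^bsub>R\<^esub> (z j mod int p)) = (\<Sum>j\<in>{1..m}. A i j * z j) mod int p"
        by (simp add: res_mult_eq mod_mult_right_eq sum_cong)
      also have "\<dots> = 0" using sol[OF i, of y] by (simp add: z_def)
      finally show ?thesis by (simp add: res_zero_eq)
    qed
    moreover have "\<chi> (z k mod int p) = Suc \<kappa>" for k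
      using z[of k] \<chi>_unit[of "z k"] by (auto simp: c_def)
    ultimately have "monochromatic_solution R n m A \<chi> (\<lambda>k. z k mod int p)"
      unfolding monochromatic_solution_def using unit z by blast
    then show ?thesis unfolding R_def by blast
  qed
  then show ?thesis by (intro exI[of _ N]) (meson not_le)
qed

end
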